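(* Let $s\in\mathbb{C}$ with $\Re(s)\ge 1$, and let $u,c\in(0,1)$. Then $$\Gamma(s)(1+u)^{-s}=\frac{1}{2\pi i}\int_{c-i\infty}^{c+i\infty}\Gamma(z)\,\Gamma(s-z)\,u^{-z}\,dz .$$
   Context: $\Gamma$ is the Gamma function. The integral is taken along the vertical line $\Re(z)=c$, oriented upwards. *)

theory Defs
  imports "HOL-Analysis.Analysis"
begin

text \<open>
  The upward vertical line \<open>Re z = c\<close> is parametrised by \<open>z = c + \<i> t\<close> with \<open>t\<close> real,
  so \<open>dz = \<i> dt\<close>. The integral over the line is the Lebesgue integral in \<open>t\<close>, which means
  that convergence is absolute convergence.
\<close>

definition vertical_line_integrable :: "real \<Rightarrow> (complex \<Rightarrow> complex) \<Rightarrow> bool" where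
  "vertical_line_integrable c f \<longleftrightarrow> integrable lborel (\<lambda>t::real. f (Complex c t) * \<i>)"

definition vertical_line_integral :: "real \<Rightarrow> (complex \<Rightarrow> complex) \<Rightarrow> complex" where
  "vertical_line_integral c f = (LINT t|lborel. f (Complex c t) * \<i>)"

end

theory Submission
  imports Defs "HOL-Probability.Probability"
begin

text \<open>
  With \<open>x = exp y\<close>, Euler's integral says that \<open>t \<mapsto> Gamma (c + \<i> t)\<close> is the Fourier transform of
  \<open>y \<mapsto> exp (c y - exp y)\<close>. It is integrable, because \<open>Gamma z = Gamma (z + 2) / (z (z + 1))\<close>
  decays quadratically on the line, so Fourier inversion gives the Cahen--Mellin formula
  \<open>\<integral> Gamma z * exp (- z v) dt = 2 pi exp (- exp v)\<close>. Expanding \<open>Gamma (s - z)\<close> by Euler's integral,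
  exchanging the integrals and using this formula at \<open>v = y + ln u\<close> leaves Euler's integral
  for \<open>Gamma s\<close> with \<open>exp y\<close> scaled by \<open>1 + u\<close>.
\<close>

text \<open>By Tonelli a product of two integrable functions of separate variables is integrable on
  the plane, and domination passes this on. It justifies both exchanges of integrals, in
  \<open>fourier_inversion\<close> and in the theorem.\<close>

lemma integrable_pair_lborel_bound:
  fixes f :: "real \<times> real \<Rightarrow> complex" and a b :: "real \<Rightarrow> real"
  assumes f: "f \<in> borel_measurable (lborel \<Otimes>\<^sub>M lborel)"
    and a: "integrable lborel a" and b: "integrable lborel b"
    and le: "\<And>x y. norm (f (x, y)) \<le> a x * b y"
  shows "integrable (lborel \<Otimes>\<^sub>M lborel) f"
proof -
  have [measurable]: "a \<in> borel_measurable lborel" "b \<in> borel_measurable lborel"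
    using a b by auto
  have "integrable (lborel \<Otimes>\<^sub>M lborel) (\<lambda>p. a (fst p) * b (snd p))"
  proof (rule lborel_pair.Fubini_integrable)
    show "(\<lambda>p. a (fst p) * b (snd p)) \<in> borel_measurable (lborel \<Otimes>\<^sub>M lborel)"
      by measurable
    show "integrable lborel (\<lambda>x. \<integral>y. norm (a (fst (x, y)) * b (snd (x, y))) \<partial>lborel)"
      using a by (simp add: abs_mult)
    show "AE x in lborel. integrable lborel (\<lambda>y. a (fst (x, y)) * b (snd (x, y)))"
      using b by simp
  qed
  then show ?thesis
    by (rule Bochner_Integration.integrable_bound)
       (use f le in \<open>auto intro!: AE_I2 order.trans[OF le abs_ge_self]\<close>)
qed

section \<open>Gaussian integrals and Fourier inversion\<close>

lemma integral_std_normal_iexp: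
  "(\<integral>x. std_normal_density x *\<^sub>R iexp (a * x) \<partial>lborel) = exp (- a\<^sup>2 / 2)"
proof -
  have "char std_normal_distribution a = (\<integral>x. std_normal_density x *\<^sub>R iexp (a * x) \<partial>lborel)"
    unfolding char_def by (subst integral_density) auto
  then show ?thesis
    by (simp add: char_std_normal_distribution)
qed

text \<open>Substituting \<open>t = x / r\<close> reduces to the characteristic function of the
  standard normal law. As a function of \<open>a\<close> the result is \<open>sqrt (2 * pi)\<close>
  times the normal density with standard deviation \<open>r\<close>, an approximate identity as
  \<open>r\<close> tends to 0.\<close>

lemma integral_dilated_gaussian_iexp:
  fixes r a :: real
  assumes "r > 0"
  shows "(\<integral>t. std_normal_density (r * t) *\<^sub>R iexp (a * t) \<partial>lborel)
           = complex_of_real (exp (- (a / r)\<^sup>2 / 2) / r)"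
proof -
  have "(\<integral>t. std_normal_density (r * t) *\<^sub>R iexp (a * t) \<partial>lborel)
      = \<bar>1 / r\<bar> *\<^sub>R (\<integral>x. std_normal_density (r * (0 + (1 / r) * x)) *\<^sub>R iexp (a * (0 + (1 / r) * x)) \<partial>lborel)"
    using assms by (intro lborel_integral_real_affine) auto
  also have "\<dots> = (1 / r) *\<^sub>R (\<integral>x. std_normal_density x *\<^sub>R iexp ((a / r) * x) \<partial>lborel)"
    using assms by simp
  also have "\<dots> = complex_of_real (exp (- (a / r)\<^sup>2 / 2) / r)"
    by (subst integral_std_normal_iexp) (simp add: scaleR_conv_of_real)
  finally show ?thesis .
qed

text \<open>
  The frequency integral is damped by a Gaussian of width \<open>1 / r\<close>: Fubini turns it into a
  Gaussian average of \<open>g\<close> around \<open>v\<close>, and both sides converge by dominated convergence as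
  \<open>r\<close> tends to \<open>0\<close>.
\<close>

lemma fourier_inversion:
  fixes g :: "real \<Rightarrow> complex"
  assumes g: "integrable lborel g" and cont: "continuous_on UNIV g"
    and bound: "\<And>y. norm (g y) \<le> B"
    and ghat: "integrable lborel (\<lambda>t. \<integral>y. g y * iexp (t * y) \<partial>lborel)"
  shows "(\<integral>t. (\<integral>y. g y * iexp (t * y) \<partial>lborel) * iexp (- (t * v)) \<partial>lborel) = 2 * of_real pi * g v"
proof -
  define h where "h t = (\<integral>y. g y * iexp (t * y) \<partial>lborel)" for t
  define r where "r n = 1 / real (Suc n)" for n
  have r_pos: "r n > 0" for n
    by (simp add: r_def)
  have r_lim: "r \<longlonglongrightarrow> 0"
    unfolding r_def using LIMSEQ_inverse_real_of_nat by (simp add: inverse_eq_divide)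
  have [measurable]: "g \<in> borel_measurable borel" "h \<in> borel_measurable borel"
    using g ghat by (auto simp: h_def[abs_def])
  have gv: "isCont g y" for y
    using cont by (simp add: continuous_on_eq_continuous_at)
  have dens_le: "std_normal_density x \<le> std_normal_density 0" for x
    by (simp add: std_normal_density_def divide_right_mono)
  have dens_lim: "(\<lambda>n. std_normal_density (r n * t)) \<longlonglongrightarrow> std_normal_density 0" for t
    unfolding std_normal_density_def by (auto intro!: tendsto_eq_intros r_lim)
  have damped: "(\<integral>t. std_normal_density (r n * t) *\<^sub>R (h t * iexp (- (t * v))) \<partial>lborel)
      = sqrt (2 * pi) *\<^sub>R (\<integral>x. std_normal_density x *\<^sub>R g (v + r n * x) \<partial>lborel)" for n
  proof -
    let ?F = "\<lambda>t y. std_normal_density (r n * t) *\<^sub>R (g y * iexp (t * (y - v)))"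
    have int: "integrable (lborel \<Otimes>\<^sub>M lborel) (\<lambda>(t, y). ?F t y)"
    proof (rule integrable_pair_lborel_bound)
      show "integrable lborel (\<lambda>t. std_normal_density (r n * t))"
        using lborel_integrable_real_affine[of std_normal_density "r n" 0] r_pos[of n] by auto
      show "integrable lborel (\<lambda>y. norm (g y))"
        using g by simp
    qed (auto simp: norm_mult)
    have "(\<integral>t. std_normal_density (r n * t) *\<^sub>R (h t * iexp (- (t * v))) \<partial>lborel)
        = (\<integral>t. (\<integral>y. ?F t y \<partial>lborel) \<partial>lborel)"
    proof (rule Bochner_Integration.integral_cong)
      fix t
      have "(\<integral>y. ?F t y \<partial>lborel)
          = (\<integral>y. std_normal_density (r n * t) *\<^sub>R ((g y * iexp (t * y)) * iexp (- (t * v))) \<partial>lborel)"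
        by (intro Bochner_Integration.integral_cong)
           (simp_all add: exp_add [symmetric] algebra_simps)
      also have "\<dots> = std_normal_density (r n * t) *\<^sub>R (h t * iexp (- (t * v)))"
        unfolding h_def by simp
      finally show "std_normal_density (r n * t) *\<^sub>R (h t * iexp (- (t * v))) = (\<integral>y. ?F t y \<partial>lborel)"
        by (rule sym)
    qed simp
    also have "\<dots> = (\<integral>y. (\<integral>t. ?F t y \<partial>lborel) \<partial>lborel)"
      using lborel_pair.Fubini_integral[OF int] by simp
    also have "\<dots> = (\<integral>y. g y * complex_of_real (exp (- ((y - v) / r n)\<^sup>2 / 2) / r n) \<partial>lborel)"
    proof (rule Bochner_Integration.integral_cong)
      fix y
      have "(\<integral>t. ?F t y \<partial>lborel)
          = (\<integral>t. g y * (std_normal_density (r n * t) *\<^sub>R iexp ((y - v) * t)) \<partial>lborel)"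
        by (intro Bochner_Integration.integral_cong) (simp_all add: mult_ac)
      then show "(\<integral>t. ?F t y \<partial>lborel) = g y * complex_of_real (exp (- ((y - v) / r n)\<^sup>2 / 2) / r n)"
        by (simp only: integral_mult_right_zero integral_dilated_gaussian_iexp[OF r_pos])
    qed simp
    \<comment> \<open>Substitute \<open>y = v + r n * x\<close>: the Jacobian cancels the division
      by \<open>r n\<close>, and the remaining exponential is \<open>sqrt (2 * pi)\<close> times the
      standard normal density at \<open>x\<close>.\<close>
    also have "\<dots> = \<bar>r n\<bar> *\<^sub>R (\<integral>x. g (v + r n * x) *
        complex_of_real (exp (- ((v + r n * x - v) / r n)\<^sup>2 / 2) / r n) \<partial>lborel)"
      using r_pos[of n] by (intro lborel_integral_real_affine) auto
    also have "\<dots> = (\<integral>x. sqrt (2 * pi) *\<^sub>R (std_normal_density x *\<^sub>R g (v + r n * x)) \<partial>lborel)"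
      using r_pos[of n]
      by (subst integral_scaleR_right [symmetric], intro Bochner_Integration.integral_cong)
         (simp_all add: std_normal_density_def scaleR_conv_of_real field_simps)
    finally show ?thesis
      by (simp only: integral_scaleR_right)
  qed
  have "(\<lambda>n. \<integral>t. std_normal_density (r n * t) *\<^sub>R (h t * iexp (- (t * v))) \<partial>lborel)
      \<longlonglongrightarrow> (\<integral>t. std_normal_density 0 *\<^sub>R (h t * iexp (- (t * v))) \<partial>lborel)"
  proof (rule integral_dominated_convergence)
    \<comment> \<open>The Gaussian is largest at 0, so a constant multiple of
      \<open>norm (h t)\<close> dominates for every \<open>n\<close>; it is integrable by
      \<open>ghat\<close>.\<close>
    show "integrable lborel (\<lambda>t. std_normal_density 0 * norm (h t))"
      using ghat by (simp add: h_def[abs_def])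
    show "AE t in lborel. norm (std_normal_density (r n * t) *\<^sub>R (h t * iexp (- (t * v))))
        \<le> std_normal_density 0 * norm (h t)" for n
      by (intro AE_I2) (simp add: norm_mult mult_right_mono dens_le)
  qed (auto intro!: tendsto_scaleR dens_lim)
  \<comment> \<open>Here the bound \<open>B\<close> on \<open>g\<close> gives the dominating
    function, and continuity of \<open>g\<close> at \<open>v\<close> gives the pointwise
    limit.\<close>
  moreover have "(\<lambda>n. sqrt (2 * pi) *\<^sub>R (\<integral>x. std_normal_density x *\<^sub>R g (v + r n * x) \<partial>lborel))
      \<longlonglongrightarrow> sqrt (2 * pi) *\<^sub>R (\<integral>x. std_normal_density x *\<^sub>R g v \<partial>lborel)"
  proof (intro tendsto_scaleR tendsto_const integral_dominated_convergence)
    show "integrable lborel (\<lambda>x. std_normal_density x * B)"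
      by simp
    show "AE x in lborel. norm (std_normal_density x *\<^sub>R g (v + r n * x)) \<le> std_normal_density x * B" for n
      by (intro AE_I2) (simp add: mult_left_mono bound)
    show "AE x in lborel. (\<lambda>n. std_normal_density x *\<^sub>R g (v + r n * x)) \<longlonglongrightarrow> std_normal_density x *\<^sub>R g v"
      by (intro AE_I2 tendsto_scaleR tendsto_const isCont_tendsto_compose[OF gv])
         (auto intro!: tendsto_eq_intros r_lim)
  qed auto
  ultimately have "(\<integral>t. std_normal_density 0 *\<^sub>R (h t * iexp (- (t * v))) \<partial>lborel)
      = sqrt (2 * pi) *\<^sub>R (\<integral>x. std_normal_density x *\<^sub>R g v \<partial>lborel)"
    unfolding damped by (rule LIMSEQ_unique)
  also have "(\<integral>x. std_normal_density x *\<^sub>R g v \<partial>lborel) = g v"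
    by simp
  finally have "std_normal_density 0 *\<^sub>R (\<integral>t. h t * iexp (- (t * v)) \<partial>lborel) = sqrt (2 * pi) *\<^sub>R g v"
    by (simp only: integral_scaleR_right)
  \<comment> \<open>\<open>std_normal_density 0\<close> is \<open>1 / sqrt (2 * pi)\<close>, so
    moving it to the right yields the constant \<open>2 * pi\<close>.\<close>
  then have "(1 / sqrt (2 * pi)) *\<^sub>R (\<integral>t. h t * iexp (- (t * v)) \<partial>lborel) = sqrt (2 * pi) *\<^sub>R g v"
    by (simp add: std_normal_density_def)
  then have "sqrt (2 * pi) *\<^sub>R (1 / sqrt (2 * pi)) *\<^sub>R (\<integral>t. h t * iexp (- (t * v)) \<partial>lborel)
      = (sqrt (2 * pi) * sqrt (2 * pi)) *\<^sub>R g v"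
    by (simp only: scaleR_scaleR)
  then show ?thesis
    unfolding h_def by (simp add: scaleR_conv_of_real)
qed

section \<open>The Gamma function on vertical lines\<close>

lemma Gamma_exp_integral:
  fixes z :: complex
  assumes "Re z > 0"
  shows "integrable lborel (\<lambda>y. exp (z * of_real y - of_real (exp y)))"
    and "(\<integral>y. exp (z * of_real y - of_real (exp y)) \<partial>lborel) = Gamma z"
proof -
  let ?f = "\<lambda>y::real. exp (z * of_real y - of_real (exp y))"
  let ?h = "\<lambda>x::real. complex_of_real x powr (z - 1) / of_real (exp x)"
  have ein: "einterval 0 \<infinity> = {0<..}" "einterval (-\<infinity>) \<infinity> = UNIV"
    by (auto simp: einterval_def)
  have lim0: "((ereal \<circ> ln \<circ> real_of_ereal) \<longlongrightarrow> -\<infinity>) (at_right (0::ereal))"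
    unfolding zero_ereal_def comp_assoc [symmetric] ereal_tendsto_simps1 ereal_tendsto_simps2
    by (rule ln_at_0)
  have limi: "((ereal \<circ> ln \<circ> real_of_ereal) \<longlongrightarrow> \<infinity>) (at_left \<infinity>)"
    unfolding comp_assoc [symmetric] ereal_tendsto_simps1 ereal_tendsto_simps2
    by (rule ln_at_top)
  \<comment> \<open>Under \<open>y = ln x\<close> one has \<open>dy = dx / x\<close>, and this
    factor \<open>1 / x\<close> lowers the exponent from \<open>z\<close> to \<open>z - 1\<close>,
    giving Euler's integrand.\<close>
  have sub: "(1 / x) *\<^sub>R ?f (ln x) = ?h x" if "x > 0" for x :: real
    using that by (simp add: powr_def exp_diff Ln_of_real scaleR_conv_of_real field_simps exp_of_real)
  have h_int: "set_integrable lborel {0<..} ?h"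
    unfolding set_integrable_def
  \<comment> \<open>The known absolute integrability concerns the completed measure; Borel
    measurability of the integrand carries it over to \<open>lborel\<close>.\<close>
  proof (subst integrable_completion [symmetric])
    show "(\<lambda>x. indicator {0<..} x *\<^sub>R ?h x) \<in> borel_measurable lborel"
      by (auto intro!: borel_measurable_continuous_on_indicator continuous_intros)
    show "integrable lebesgue (\<lambda>x. indicator {0<..} x *\<^sub>R ?h x)"
      using absolutely_integrable_Gamma_integral'[OF assms] by (simp add: set_integrable_def)
  qed
  have set_int: "set_integrable lborel (einterval 0 \<infinity>) (\<lambda>x. (1 / x) *\<^sub>R ?f (ln x))"
    unfolding ein by (subst set_integrable_cong[OF refl refl sub]) (use h_int in auto)
  \<comment> \<open>The substitution rule for complex integrands requires integrability on both
    sides. The rule for nonnegative integrands delivers it on the \<open>y\<close> side, so it is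
    applied to the norm first.\<close>
  have "set_integrable lborel (einterval (-\<infinity>) \<infinity>) (\<lambda>y. norm (?f y))"
  proof (rule interval_integral_substitution_nonneg(1))
    have "set_integrable lborel (einterval 0 \<infinity>) (\<lambda>x. norm ((1 / x) *\<^sub>R ?f (ln x)))"
      using set_int by (rule set_integrable_norm)
    then show "set_integrable lborel (einterval 0 \<infinity>) (\<lambda>x. norm (?f (ln x)) * (1 / x))"
      by (subst set_integrable_cong[OF refl refl]) (auto simp: ein field_simps)
    show "DERIV ln x :> 1 / x" if "0 < ereal x" for x
      using that by (auto intro!: derivative_eq_intros)
  qed (use lim0 limi in \<open>auto intro!: continuous_intros\<close>)
  then have f_int: "set_integrable lborel (einterval (-\<infinity>) \<infinity>) ?f"
    unfolding ein set_integrable_def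
    by (auto intro: Bochner_Integration.integrable_bound)
  then show "integrable lborel ?f"
    by (simp add: ein set_integrable_def)
  have "(LBINT y=-\<infinity>..\<infinity>. ?f y) = (LBINT x=0..\<infinity>. (1 / x) *\<^sub>R ?f (ln x))"
  proof (rule interval_integral_substitution_integrable)
    show "DERIV ln x :> 1 / x" if "0 < ereal x" for x
      using that by (auto intro!: derivative_eq_intros)
  qed (use lim0 limi set_int f_int in \<open>auto intro!: continuous_intros\<close>)
  also have "(LBINT x=0..\<infinity>. (1 / x) *\<^sub>R ?f (ln x)) = (LBINT x:{0<..}. ?h x)"
    unfolding interval_lebesgue_integral_def ein
    by (simp, intro set_lebesgue_integral_cong allI impI sub) auto
  also have "\<dots> = Gamma z"
    using set_borel_integral_eq_integral(2)[OF h_int] Gamma_integral_complex'[OF assms]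
    by (simp add: integral_unique)
  finally show "(\<integral>y. ?f y \<partial>lborel) = Gamma z"
    by (simp add: interval_lebesgue_integral_def ein set_lebesgue_integral_def)
qed

text \<open>The modulus of the integrand \<open>exp (z * y - exp y)\<close> depends only on
  \<open>Re z\<close>, so the triangle inequality for integrals gives a bound that is uniform on
  each vertical line.\<close>

lemma norm_Gamma_le:
  assumes "Re z > 0"
  shows "norm (Gamma z) \<le> Gamma (Re z)"
proof -
  have "norm (Gamma z) \<le> (\<integral>y. norm (exp (z * of_real y - of_real (exp y))) \<partial>lborel)"
    unfolding Gamma_exp_integral(2)[OF assms, symmetric] by (rule integral_norm_bound)
  \<comment> \<open>The norm is the real part of the same integrand at the real point
    \<open>Re z\<close>, which makes the complex formula applicable again.\<close>
  also have "\<dots> = Re (\<integral>y. exp (of_real (Re z) * of_real y - of_real (exp y)) \<partial>lborel)"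
    using assms by (subst integral_Re [symmetric])
      (auto simp: Re_exp intro!: Gamma_exp_integral Bochner_Integration.integral_cong)
  also have "\<dots> = Gamma (Re z)"
    using assms by (subst Gamma_exp_integral) (auto simp: Gamma_complex_of_real)
  finally show ?thesis .
qed

lemma vertical_notin_nonpos_Ints:
  assumes "c > 0"
  shows "Complex c t \<notin> \<int>\<^sub>\<le>\<^sub>0"
  using assms by (auto elim!: nonpos_Ints_cases simp: complex_eq_iff)

lemma continuous_on_Gamma_vertical [continuous_intros]:
  assumes "c > 0" "continuous_on A f"
  shows "continuous_on A (\<lambda>x. Gamma (Complex c (f x)))"
proof -
  have "continuous_on (- \<int>\<^sub>\<le>\<^sub>0) (Gamma :: complex \<Rightarrow> complex)"
    by (intro continuous_on_Gamma) auto
  moreover have "continuous_on A (\<lambda>x. Complex c (f x))"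
    using assms by (intro continuous_intros)
  ultimately show ?thesis
    by (rule continuous_on_compose2) (use assms vertical_notin_nonpos_Ints in auto)
qed

lemma integrable_Gamma_vertical:
  assumes c: "c > 0"
  shows "integrable lborel (\<lambda>t. Gamma (Complex c t))"
proof (rule Bochner_Integration.integrable_bound)
  \<comment> \<open>As \<open>m\<close> is at most 1 and at most \<open>c^2\<close>, the quantity
    \<open>m * (1 + t^2)\<close> stays below \<open>c^2 + t^2\<close>, the squared modulus of the
    point on the line.\<close>
  define m where "m = min 1 (c\<^sup>2)"
  have m: "m > 0" "m \<le> 1" "m \<le> c\<^sup>2"
    using c by (auto simp: m_def)
  show "integrable lborel (\<lambda>t. Gamma (c + 2) / m * inverse (1 + t\<^sup>2))"
    using integrable_inverse_1_plus_square by (simp add: set_integrable_def einterval_def)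
  show "(\<lambda>t. Gamma (Complex c t)) \<in> borel_measurable lborel"
    using c by (auto intro!: borel_measurable_continuous_onI continuous_intros)
  show "AE t in lborel. norm (Gamma (Complex c t)) \<le> norm (Gamma (c + 2) / m * inverse (1 + t\<^sup>2))"
  proof (intro AE_I2)
    fix t
    let ?z = "Complex c t"
    have z: "?z \<notin> \<int>\<^sub>\<le>\<^sub>0" "?z + 1 \<notin> \<int>\<^sub>\<le>\<^sub>0"
      using c by (auto elim!: nonpos_Ints_cases simp: complex_eq_iff)
    have "Gamma (?z + 2) = (?z + 1) * (?z * Gamma ?z)"
      using Gamma_plus1[OF z(1)] Gamma_plus1[OF z(2)] by (simp add: add.assoc)
    then have eq: "norm (Gamma (?z + 2)) = norm (?z + 1) * norm ?z * norm (Gamma ?z)"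
      by (simp add: norm_mult)
    have "m * (1 + t\<^sup>2) \<le> c\<^sup>2 + t\<^sup>2"
      using m mult_right_mono[of m 1 "t\<^sup>2"] by (simp add: algebra_simps)
    also have "\<dots> = norm ?z * norm ?z"
      by (simp add: cmod_def)
    \<comment> \<open>Since the real part \<open>c\<close> is positive, adding 1 moves the point
      away from 0.\<close>
    also have "\<dots> \<le> norm (?z + 1) * norm ?z"
      using c by (intro mult_right_mono) (auto simp: cmod_def intro!: power_mono)
    finally have "m * (1 + t\<^sup>2) * norm (Gamma ?z) \<le> norm (Gamma (?z + 2))"
      unfolding eq by (intro mult_right_mono) auto
    also have "\<dots> \<le> Gamma (c + 2)"
      using norm_Gamma_le[of "?z + 2"] c by simp
    finally have "norm (Gamma ?z) \<le> Gamma (c + 2) / (m * (1 + t\<^sup>2))"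
      using m by (subst pos_le_divide_eq) (auto simp: mult_ac add_pos_nonneg)
    also have "\<dots> = Gamma (c + 2) / m * inverse (1 + t\<^sup>2)"
      by (simp add: divide_inverse)
    also have "\<dots> \<le> norm (Gamma (c + 2) / m * inverse (1 + t\<^sup>2))"
      unfolding real_norm_def by (rule abs_ge_self)
    finally show "norm (Gamma ?z) \<le> norm (Gamma (c + 2) / m * inverse (1 + t\<^sup>2))" .
  qed
qed

section \<open>The Cahen--Mellin formula and the dilated Euler integral\<close>

lemma cahen_mellin:
  assumes c: "c > 0"
  shows "(\<integral>t. Gamma (Complex c t) * exp (- (Complex c t * of_real v)) \<partial>lborel)
           = 2 * of_real pi * of_real (exp (- exp v))"
proof -
  \<comment> \<open>The real part of \<open>z = Complex c t\<close> goes into the weight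
    \<open>g\<close>; its imaginary part \<open>t\<close> is the frequency.\<close>
  define g where "g y = exp (of_real c * of_real y - complex_of_real (exp y))" for y
  have ghat: "(\<integral>y. g y * iexp (t * y) \<partial>lborel) = Gamma (Complex c t)" for t
  proof -
    have "(\<integral>y. g y * iexp (t * y) \<partial>lborel)
        = (\<integral>y. exp (Complex c t * of_real y - of_real (exp y)) \<partial>lborel)"
      by (intro Bochner_Integration.integral_cong)
         (simp_all add: g_def exp_add [symmetric] Complex_eq algebra_simps)
    then show ?thesis
      using c by (simp add: Gamma_exp_integral)
  qed
  have "norm (g y) \<le> exp (c * ln c - c)" for y
  proof -
    \<comment> \<open>The exponent \<open>c * y - exp y\<close> is maximal at
      \<open>y = ln c\<close>; the tangent to \<open>exp\<close> at that point proves the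
      bound.\<close>
    have "1 + (y - ln c) \<le> exp (y - ln c)"
      by (rule exp_ge_add_one_self)
    then have "c * (1 + (y - ln c)) \<le> exp y"
      using c by (simp add: exp_diff field_simps)
    then show ?thesis
      by (simp add: g_def algebra_simps)
  qed
  then have "(\<integral>t. (\<integral>y. g y * iexp (t * y) \<partial>lborel) * iexp (- (t * v)) \<partial>lborel) = 2 * of_real pi * g v"
  proof (rule fourier_inversion[rotated 2])
    show "integrable lborel g"
      unfolding g_def using c by (intro Gamma_exp_integral) simp
    show "continuous_on UNIV g"
      unfolding g_def by (intro continuous_intros)
    show "integrable lborel (\<lambda>t. \<integral>y. g y * iexp (t * y) \<partial>lborel)"
      unfolding ghat using c by (rule integrable_Gamma_vertical)
  qed
  then have inv: "(\<integral>t. Gamma (Complex c t) * iexp (- (t * v)) \<partial>lborel) = 2 * of_real pi * g v"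
    by (simp only: ghat)
  \<comment> \<open>The factor \<open>exp (- c * v)\<close> restores the real part of
    \<open>z\<close> in the kernel, and it cancels the factor \<open>exp (c * v)\<close> of
    \<open>g v\<close>.\<close>
  have "(\<integral>t. Gamma (Complex c t) * exp (- (Complex c t * of_real v)) \<partial>lborel)
      = (\<integral>t. exp (- of_real (c * v)) * (Gamma (Complex c t) * iexp (- (t * v))) \<partial>lborel)"
    by (intro Bochner_Integration.integral_cong)
       (simp_all add: Complex_eq exp_minus exp_diff exp_add divide_inverse algebra_simps)
  also have "\<dots> = exp (- of_real (c * v)) * (2 * of_real pi * g v)"
    by (simp only: integral_mult_right_zero inv)
  also have "\<dots> = 2 * of_real pi * of_real (exp (- exp v))"
    by (simp add: g_def exp_diff exp_minus field_simps exp_of_real)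
  finally show ?thesis .
qed

text \<open>Translating \<open>y\<close> by \<open>- ln a\<close> turns \<open>a * exp y\<close>
  into \<open>exp y\<close> and releases the factor \<open>exp (- s * ln a)\<close>.\<close>

lemma Gamma_exp_integral_dilated:
  fixes s :: complex
  assumes "Re s > 0" "a > 0"
  shows "(\<integral>y. exp (s * of_real y - of_real (a * exp y)) \<partial>lborel) = Gamma s * of_real a powr (- s)"
proof -
  have "(\<integral>y. exp (s * of_real y - of_real (a * exp y)) \<partial>lborel)
      = (\<integral>y. exp (s * of_real (- ln a + 1 * y) - of_real (a * exp (- ln a + 1 * y))) \<partial>lborel)"
    by (subst lborel_integral_real_affine[of 1 _ "- ln a"]) simp_all
  also have "\<dots> = (\<integral>y. of_real a powr (- s) * exp (s * of_real y - of_real (exp y)) \<partial>lborel)"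
    using assms
    by (intro Bochner_Integration.integral_cong)
       (simp_all add: powr_def Ln_of_real exp_add [symmetric] exp_diff algebra_simps)
  also have "\<dots> = Gamma s * of_real a powr (- s)"
    using assms by (simp add: Gamma_exp_integral)
  finally show ?thesis .
qed

section \<open>The Mellin--Barnes integral for the binomial power\<close>

theorem lemma2p8:
  fixes s :: complex and u c :: real
  assumes "Re s \<ge> 1"
    and "u \<in> {0<..<1}"
    and "c \<in> {0<..<1}"
  shows "vertical_line_integrable c
           (\<lambda>z. Gamma z * Gamma (s - z) * complex_of_real u powr (- z))
       \<and> Gamma s * (1 + complex_of_real u) powr (- s)
         = 1 / (2 * complex_of_real pi * \<i>) *
           vertical_line_integral c
             (\<lambda>z. Gamma z * Gamma (s - z) * complex_of_real u powr (- z))"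
proof -
  \<comment> \<open>\<open>Re s >= 1 > c\<close> keeps \<open>s - z\<close> in the right half-plane,
    where Euler's integral for \<open>Gamma (s - z)\<close> converges.\<close>
  have u: "u > 0" and c: "c > 0" and sc: "Re s - c > 0" and s: "Re s > 0"
    using assms by auto
  let ?G = "\<lambda>t. Gamma (Complex c t) * of_real u powr (- Complex c t)"
  let ?F = "\<lambda>t y. ?G t * exp ((s - Complex c t) * of_real y - of_real (exp y))"
  have norm_u: "norm (of_real u powr (- Complex c t)) = u powr (- c)" for t
    using u by (simp add: norm_powr_real_powr)
  \<comment> \<open>On the line the moduli of \<open>u powr (- z)\<close> and of the exponential are
    independent of \<open>t\<close>, so the norm of \<open>?F t y\<close> splits into a function of
    \<open>t\<close> times a function of \<open>y\<close>.\<close>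
  have int: "integrable (lborel \<Otimes>\<^sub>M lborel) (\<lambda>(t, y). ?F t y)"
  proof (rule integrable_pair_lborel_bound)
    show "integrable lborel (\<lambda>t. norm (Gamma (Complex c t)) * u powr (- c))"
      using integrable_Gamma_vertical[OF c] by simp
    show "integrable lborel (\<lambda>y. norm (exp (complex_of_real (Re s - c) * of_real y - of_real (exp y))))"
      using sc by (intro integrable_norm Gamma_exp_integral) simp
    show "(\<lambda>(t, y). ?F t y) \<in> borel_measurable (lborel \<Otimes>\<^sub>M lborel)"
    proof -
      have "continuous_on UNIV (\<lambda>p. ?F (fst p) (snd p))"
        using u c by (intro continuous_intros) auto
      then show ?thesis
        by (simp add: lborel_prod case_prod_beta borel_measurable_continuous_onI)
    qed
  qed (simp add: norm_mult norm_u)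
  have inner: "(\<integral>y. ?F t y \<partial>lborel)
      = Gamma (Complex c t) * Gamma (s - Complex c t) * of_real u powr (- Complex c t)" for t
    using sc by (simp add: Gamma_exp_integral)
  \<comment> \<open>Fubini also makes the inner \<open>y\<close>-integral an integrable function of
    \<open>t\<close>, which is the claimed absolute convergence.\<close>
  have integrable: "integrable lborel
      (\<lambda>t. Gamma (Complex c t) * Gamma (s - Complex c t) * of_real u powr (- Complex c t))"
    using lborel_pair.integrable_fst[OF int] by (simp only: inner prod.case)
  have "(\<integral>t. Gamma (Complex c t) * Gamma (s - Complex c t) * of_real u powr (- Complex c t) \<partial>lborel)
      = (\<integral>y. (\<integral>t. ?F t y \<partial>lborel) \<partial>lborel)"
    using lborel_pair.Fubini_integral[OF int] by (simp only: inner)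
  also have "\<dots> = (\<integral>y. 2 * of_real pi * exp (s * of_real y - of_real ((1 + u) * exp y)) \<partial>lborel)"
  proof (rule Bochner_Integration.integral_cong)
    fix y
    have "(\<integral>t. ?F t y \<partial>lborel) = (\<integral>t. exp (s * of_real y - of_real (exp y)) *
        (Gamma (Complex c t) * exp (- (Complex c t * of_real (y + ln u)))) \<partial>lborel)"
      using u by (intro Bochner_Integration.integral_cong)
        (simp_all add: powr_def Ln_of_real exp_add exp_diff exp_minus field_simps)
    also have "\<dots> = exp (s * of_real y - of_real (exp y)) * (2 * of_real pi * of_real (exp (- exp (y + ln u))))"
      by (simp only: integral_mult_right_zero cahen_mellin[OF c])
    \<comment> \<open>\<open>exp (y + ln u)\<close> equals \<open>u * exp y\<close>; together with
      the \<open>exp y\<close> already present this produces the dilation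
      \<open>1 + u\<close>.\<close>
    also have "\<dots> = 2 * of_real pi * exp (s * of_real y - of_real ((1 + u) * exp y))"
      using u by (simp add: exp_add exp_of_real [symmetric] exp_diff exp_minus field_simps)
    finally show "(\<integral>t. ?F t y \<partial>lborel) = 2 * of_real pi * exp (s * of_real y - of_real ((1 + u) * exp y))" .
  qed simp
  also have "\<dots> = 2 * of_real pi * (Gamma s * of_real (1 + u) powr (- s))"
    using u s by (simp only: integral_mult_right_zero) (subst Gamma_exp_integral_dilated, auto)
  \<comment> \<open>The factor \<open>\<i>\<close> from \<open>dz\<close> and the constant
    \<open>2 * pi\<close> cancel the prefactor.\<close>
  finally show ?thesis
    using integrable
    by (simp add: vertical_line_integrable_def vertical_line_integral_def)
qed

end
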